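(* Let $\mathbf k$ be a field and for $n\ge0$ let $\mathcal E^n=\mathrm{LF}(\mathcal Q^n)$ be the $\mathbb Z/2$-graded dg-category of loop factorizations of the $\mathbb Z_+$-category $\mathcal Q^n$. The collection $\mathcal E^\bullet=(\mathcal E^n)_{n\ge0}$ forms a cocyclic object in $\mathsf{dgcat}^{(2)}$, the category of small $\mathbb Z/2$-graded dg-categories over $\mathbf k$.
   Context: A $\mathbb Z_+$-category is a category $\mathcal C$ with a natural transformation $w:\mathrm{Id}_{\mathcal C}\Rightarrow\mathrm{Id}_{\mathcal C}$; a $\mathbb Z_+$-functor is a functor $F$ with $F(w_x)=w_{F(x)}$. $\mathcal Q^n$ is the free category on the circular quiver with vertices $\mathbb Z/(n+1)$ and one arrow $i\to i+1$ for each $i$, with $w_i$ the cycle of length $n+1$ at $i$. A loop factorization in $\mathcal C$ is $F=(x_1,x_0,\varphi:x_1\to x_0,\psi:x_0\to x_1)$ with $\varphi\psi=w_{x_0}$, $\psi\varphi=w_{x_1}$. $\mathrm{LF}(\mathcal C)$ is the $\mathbb Z/2$-graded dg-category whose objects are loop factorizations, with (writing $\mathbf k[\mathcal C]$ for the $\mathbf k$-linear envelope) $\mathrm{Hom}^0(F,F')=\mathrm{Hom}_{\mathbf k[\mathcal C]}(x_0,x_0')\oplus\mathrm{Hom}_{\mathbf k[\mathcal C]}(x_1,x_1')$, $\mathrm{Hom}^1(F,F')=\mathrm{Hom}_{\mathbf k[\mathcal C]}(x_1,x_0')\oplus\mathrm{Hom}_{\mathbf k[\mathcal C]}(x_0,x_1')$,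 and differential $d(h)=\delta' h-(-1)^{|h|}h\delta$, where $\delta=\varphi+\psi$ is the odd endomorphism of $x_0\oplus x_1$ and likewise $\delta'=\varphi'+\psi'$. Connes' cyclic category $\Lambda$ has objects $\langle n\rangle$, $n\ge0$; a morphism $\langle m\rangle\to\langle n\rangle$ is a homotopy class of degree-1 continuous (monotone) maps $S^1\to S^1$ taking the $(m+1)$st roots of unity to the $(n+1)$st roots of unity; equivalently (via the fully faithful functor $\langle n\rangle\mapsto\mathcal Q^n$ to $\mathbb Z_+$-categories) a $\mathbb Z_+$-functor $\mathcal Q^m\to\mathcal Q^n$. A cocyclic object in a category $\mathbf C$ is a functor $\Lambda\to\mathbf C$; here the action on morphisms is induced by the functoriality of $\mathrm{LF}$ under $\mathbb Z_+$-functors. *)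

theory Defs
  imports
    "HOL-Library.FuncSet"
    "HOL-Library.Z2"
    "HOL-Library.Poly_Mapping"
    "HOL-Algebra.Algebraic_Closure_Type"
    "Graph_Theory.Arc_Walk"
begin

section \<open>Categories and functors\<close>

record ('o, 'a) pre_category =
  Ob :: "'o set"
  Arr :: "'a set"
  Dom :: "'a \<Rightarrow> 'o"
  Cod :: "'a \<Rightarrow> 'o"
  Id :: "'o \<Rightarrow> 'a"
  Comp :: "'a \<Rightarrow> 'a \<Rightarrow> 'a"

definition Hom :: "('o, 'a, 'z) pre_category_scheme \<Rightarrow> 'o \<Rightarrow> 'o \<Rightarrow> 'a set" where
  "Hom C x y = {f \<in> Arr C. Dom C f = x \<and> Cod C f = y}"

locale category =
  fixes C :: "('o, 'a, 'z) pre_category_scheme"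
  assumes Dom_closed: "f \<in> Arr C \<Longrightarrow> Dom C f \<in> Ob C"
    and Cod_closed: "f \<in> Arr C \<Longrightarrow> Cod C f \<in> Ob C"
    and Id_closed: "x \<in> Ob C \<Longrightarrow> Id C x \<in> Hom C x x"
    and Comp_closed: "\<lbrakk>f \<in> Hom C x y; g \<in> Hom C y z\<rbrakk> \<Longrightarrow> Comp C g f \<in> Hom C x z"
    and Comp_Id: "f \<in> Hom C x y \<Longrightarrow> Comp C f (Id C x) = f"
    and Id_Comp: "f \<in> Hom C x y \<Longrightarrow> Comp C (Id C y) f = f"
    and Comp_assoc: "\<lbrakk>f \<in> Hom C w x; g \<in> Hom C x y; h \<in> Hom C y z\<rbrakk>
      \<Longrightarrow> Comp C (Comp C h g) f = Comp C h (Comp C g f)"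

record ('o, 'a, 'p, 'b) pre_functor =
  ob_map :: "'o \<Rightarrow> 'p"
  arr_map :: "'a \<Rightarrow> 'b"

locale cat_functor = source: category C + target: category D
  for C :: "('o, 'a, 'z) pre_category_scheme"
    and D :: "('p, 'b, 'y) pre_category_scheme" +
  fixes F :: "('o, 'a, 'p, 'b) pre_functor"
  assumes ob_map_closed: "x \<in> Ob C \<Longrightarrow> ob_map F x \<in> Ob D"
    and arr_map_closed:
      "f \<in> Hom C x y \<Longrightarrow> arr_map F f \<in> Hom D (ob_map F x) (ob_map F y)"
    and map_Id: "x \<in> Ob C \<Longrightarrow> arr_map F (Id C x) = Id D (ob_map F x)"
    and map_Comp: "\<lbrakk>f \<in> Hom C x y; g \<in> Hom C y z\<rbrakk>
      \<Longrightarrow> arr_map F (Comp C g f) = Comp D (arr_map F g) (arr_map F f)"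

definition functor_restrict ::
  "('o, 'a, 'z) pre_category_scheme \<Rightarrow> ('o, 'a, 'p, 'b) pre_functor \<Rightarrow> ('o, 'a, 'p, 'b) pre_functor"
  where "functor_restrict C F =
    \<lparr>ob_map = restrict (ob_map F) (Ob C), arr_map = restrict (arr_map F) (Arr C)\<rparr>"

definition functor_id :: "('o, 'a, 'o, 'a) pre_functor" where
  "functor_id = \<lparr>ob_map = (\<lambda>x. x), arr_map = (\<lambda>f. f)\<rparr>"

definition functor_comp ::
  "('p, 'b, 'q, 'c) pre_functor \<Rightarrow> ('o, 'a, 'p, 'b) pre_functor \<Rightarrow> ('o, 'a, 'q, 'c) pre_functor"
  where "functor_comp G F =
    \<lparr>ob_map = ob_map G \<circ> ob_map F, arr_map = arr_map G \<circ> arr_map F\<rparr>"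

section \<open>\<open>\<int>\<^sub>+\<close>-categories and \<open>\<int>\<^sub>+\<close>-functors\<close>

record ('o, 'a) pre_zcategory = "('o, 'a) pre_category" +
  loop :: "'o \<Rightarrow> 'a"

locale zcategory = category C for C :: "('o, 'a, 'z) pre_zcategory_scheme" +
  assumes loop_closed: "x \<in> Ob C \<Longrightarrow> loop C x \<in> Hom C x x"
    and loop_natural: "f \<in> Hom C x y \<Longrightarrow> Comp C f (loop C x) = Comp C (loop C y) f"

locale zfunctor = source: zcategory C + target: zcategory D + cat_functor C D F
  for C :: "('o, 'a, 'z) pre_zcategory_scheme"
    and D :: "('p, 'b, 'y) pre_zcategory_scheme"
    and F :: "('o, 'a, 'p, 'b) pre_functor" +
  assumes map_loop: "x \<in> Ob C \<Longrightarrow> arr_map F (loop C x) = loop D (ob_map F x)"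

section \<open>The cyclic quivers and Connes' cyclic category\<close>

text \<open>A quiver is a directed multigraph; an arrow of the free category is a directed walk
  together with its two endpoints.\<close>

definition free_category :: "('v, 'e) pre_digraph \<Rightarrow> ('v, 'v \<times> 'e list \<times> 'v) pre_category" where
  "free_category G =
    \<lparr>Ob = verts G,
     Arr = {(u, p, v). pre_digraph.awalk G u p v},
     Dom = (\<lambda>(u, p, v). u),
     Cod = (\<lambda>(u, p, v). v),
     Id = (\<lambda>u. (u, [], u)),
     Comp = (\<lambda>(v', q, w) (u, p, v). (u, p @ q, w))\<rparr>"

text \<open>The vertices \<open>\<int>/(n+1)\<close> are the residues \<open>0, \<dots>, n\<close>, and each arc carries the name of
  its tail.\<close>

definition circular_quiver :: "nat \<Rightarrow> (nat, nat) pre_digraph" where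
  "circular_quiver n =
    \<lparr>verts = {0..n}, arcs = {0..n}, tail = (\<lambda>i. i), head = (\<lambda>i. (i + 1) mod (n + 1))\<rparr>"

definition QQ :: "nat \<Rightarrow> (nat, nat \<times> nat list \<times> nat) pre_zcategory" where
  "QQ n = pre_category.extend (free_category (circular_quiver n))
    (pre_zcategory.fields (\<lambda>i. (i, map (\<lambda>k. (i + k) mod (n + 1)) [0..<n + 1], i)))"

text \<open>Connes' category: the object \<open>n\<close> stands for \<open>\<langle>n\<rangle>\<close>, and a morphism from \<open>\<langle>m\<rangle>\<close> to \<open>\<langle>n\<rangle>\<close>
  is a \<open>\<int>\<^sub>+\<close>-functor \<open>QQ m \<rightarrow> QQ n\<close>. A functor is recorded together with its source and target
  and has the value \<^term>\<open>undefined\<close> outside its source, so that equality of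
  morphisms is equality of functors.\<close>

type_synonym cyclic_functor =
  "(nat, nat \<times> nat list \<times> nat, nat, nat \<times> nat list \<times> nat) pre_functor"

definition Lambda :: "(nat, nat \<times> nat \<times> cyclic_functor) pre_category" where
  "Lambda =
    \<lparr>Ob = UNIV,
     Arr = {(m, n, F). zfunctor (QQ m) (QQ n) F \<and> functor_restrict (QQ m) F = F},
     Dom = (\<lambda>(m, n, F). m),
     Cod = (\<lambda>(m, n, F). n),
     Id = (\<lambda>n. (n, n, functor_restrict (QQ n) functor_id)),
     Comp = (\<lambda>(n', r, G) (m, n, F). (m, r, functor_restrict (QQ m) (functor_comp G F)))\<rparr>"

definition cocyclic_object ::
  "('o, 'a, 'z) pre_category_scheme \<Rightarrow> (nat, nat \<times> nat \<times> cyclic_functor, 'o, 'a) pre_functor \<Rightarrow> bool"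
  where "cocyclic_object D E \<longleftrightarrow> cat_functor Lambda D E"

section \<open>\<open>\<int>/2\<close>-graded dg-categories\<close>

text \<open>Degrees are elements of \<^typ>\<open>bit\<close>, the integers modulo 2. \<open>dgHom A i x y\<close> is the module of
  morphisms \<open>x \<rightarrow> y\<close> of degree \<open>i\<close>; its ring multiplication and unit, which are part of the record
  type \<open>module\<close>, play no role. \<open>dgComp A j i x y z g f\<close> composes \<open>g : y \<rightarrow> z\<close> of degree \<open>j\<close>
  with \<open>f : x \<rightarrow> y\<close> of degree \<open>i\<close>.\<close>

record ('k, 'o, 'h) pre_dgcategory =
  dgOb :: "'o set"
  dgHom :: "bit \<Rightarrow> 'o \<Rightarrow> 'o \<Rightarrow> ('k, 'h) module"
  dgId :: "'o \<Rightarrow> 'h"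
  dgComp :: "bit \<Rightarrow> bit \<Rightarrow> 'o \<Rightarrow> 'o \<Rightarrow> 'o \<Rightarrow> 'h \<Rightarrow> 'h \<Rightarrow> 'h"
  dgDiff :: "bit \<Rightarrow> 'o \<Rightarrow> 'o \<Rightarrow> 'h \<Rightarrow> 'h"

locale dg_category =
  fixes K :: "'k ring" and A :: "('k, 'o, 'h) pre_dgcategory"
  assumes Hom_module:
      "\<lbrakk>x \<in> dgOb A; y \<in> dgOb A\<rbrakk> \<Longrightarrow> Module.module K (dgHom A i x y)"
    and Id_closed: "x \<in> dgOb A \<Longrightarrow> dgId A x \<in> carrier (dgHom A 0 x x)"
    and Comp_closed:
      "\<lbrakk>x \<in> dgOb A; y \<in> dgOb A; z \<in> dgOb A;
        f \<in> carrier (dgHom A i x y); g \<in> carrier (dgHom A j y z)\<rbrakk>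
       \<Longrightarrow> dgComp A j i x y z g f \<in> carrier (dgHom A (j + i) x z)"
    and Comp_add_left:
      "\<lbrakk>x \<in> dgOb A; y \<in> dgOb A; z \<in> dgOb A; f \<in> carrier (dgHom A i x y);
        g \<in> carrier (dgHom A j y z); g' \<in> carrier (dgHom A j y z)\<rbrakk>
       \<Longrightarrow> dgComp A j i x y z (g \<oplus>\<^bsub>dgHom A j y z\<^esub> g') f =
           dgComp A j i x y z g f \<oplus>\<^bsub>dgHom A (j + i) x z\<^esub> dgComp A j i x y z g' f"
    and Comp_add_right:
      "\<lbrakk>x \<in> dgOb A; y \<in> dgOb A; z \<in> dgOb A; f \<in> carrier (dgHom A i x y);
        f' \<in> carrier (dgHom A i x y); g \<in> carrier (dgHom A j y z)\<rbrakk>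
       \<Longrightarrow> dgComp A j i x y z g (f \<oplus>\<^bsub>dgHom A i x y\<^esub> f') =
           dgComp A j i x y z g f \<oplus>\<^bsub>dgHom A (j + i) x z\<^esub> dgComp A j i x y z g f'"
    and Comp_smult_left:
      "\<lbrakk>x \<in> dgOb A; y \<in> dgOb A; z \<in> dgOb A; c \<in> carrier K;
        f \<in> carrier (dgHom A i x y); g \<in> carrier (dgHom A j y z)\<rbrakk>
       \<Longrightarrow> dgComp A j i x y z (c \<odot>\<^bsub>dgHom A j y z\<^esub> g) f =
           c \<odot>\<^bsub>dgHom A (j + i) x z\<^esub> dgComp A j i x y z g f"
    and Comp_smult_right:
      "\<lbrakk>x \<in> dgOb A; y \<in> dgOb A; z \<in> dgOb A; c \<in> carrier K;
        f \<in> carrier (dgHom A i x y); g \<in> carrier (dgHom A j y z)\<rbrakk>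
       \<Longrightarrow> dgComp A j i x y z g (c \<odot>\<^bsub>dgHom A i x y\<^esub> f) =
           c \<odot>\<^bsub>dgHom A (j + i) x z\<^esub> dgComp A j i x y z g f"
    and Comp_Id:
      "\<lbrakk>x \<in> dgOb A; y \<in> dgOb A; f \<in> carrier (dgHom A i x y)\<rbrakk>
       \<Longrightarrow> dgComp A i 0 x x y f (dgId A x) = f"
    and Id_Comp:
      "\<lbrakk>x \<in> dgOb A; y \<in> dgOb A; f \<in> carrier (dgHom A i x y)\<rbrakk>
       \<Longrightarrow> dgComp A 0 i x y y (dgId A y) f = f"
    and Comp_assoc:
      "\<lbrakk>w \<in> dgOb A; x \<in> dgOb A; y \<in> dgOb A; z \<in> dgOb A; f \<in> carrier (dgHom A i w x);
        g \<in> carrier (dgHom A j x y); h \<in> carrier (dgHom A l y z)\<rbrakk>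
       \<Longrightarrow> dgComp A (l + j) i w x z (dgComp A l j x y z h g) f =
           dgComp A l (j + i) w y z h (dgComp A j i w x y g f)"
    and Diff_closed:
      "\<lbrakk>x \<in> dgOb A; y \<in> dgOb A; f \<in> carrier (dgHom A i x y)\<rbrakk>
       \<Longrightarrow> dgDiff A i x y f \<in> carrier (dgHom A (i + 1) x y)"
    and Diff_add:
      "\<lbrakk>x \<in> dgOb A; y \<in> dgOb A; f \<in> carrier (dgHom A i x y); f' \<in> carrier (dgHom A i x y)\<rbrakk>
       \<Longrightarrow> dgDiff A i x y (f \<oplus>\<^bsub>dgHom A i x y\<^esub> f') =
           dgDiff A i x y f \<oplus>\<^bsub>dgHom A (i + 1) x y\<^esub> dgDiff A i x y f'"
    and Diff_smult:
      "\<lbrakk>x \<in> dgOb A; y \<in> dgOb A; c \<in> carrier K; f \<in> carrier (dgHom A i x y)\<rbrakk>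
       \<Longrightarrow> dgDiff A i x y (c \<odot>\<^bsub>dgHom A i x y\<^esub> f) =
           c \<odot>\<^bsub>dgHom A (i + 1) x y\<^esub> dgDiff A i x y f"
    and Diff_Diff:
      "\<lbrakk>x \<in> dgOb A; y \<in> dgOb A; f \<in> carrier (dgHom A i x y)\<rbrakk>
       \<Longrightarrow> dgDiff A (i + 1) x y (dgDiff A i x y f) = \<zero>\<^bsub>dgHom A i x y\<^esub>"
    and Leibniz:
      "\<lbrakk>x \<in> dgOb A; y \<in> dgOb A; z \<in> dgOb A;
        f \<in> carrier (dgHom A i x y); g \<in> carrier (dgHom A j y z)\<rbrakk>
       \<Longrightarrow> dgDiff A (j + i) x z (dgComp A j i x y z g f) =
           dgComp A (j + 1) i x y z (dgDiff A j y z g) f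
           \<oplus>\<^bsub>dgHom A (j + i + 1) x z\<^esub>
           (let r = dgComp A j (i + 1) x y z g (dgDiff A i x y f)
            in if j = 0 then r else \<ominus>\<^bsub>dgHom A (j + i + 1) x z\<^esub> r)"

record ('o, 'h, 'p, 'g) pre_dgfunctor =
  dgob_map :: "'o \<Rightarrow> 'p"
  dghom_map :: "bit \<Rightarrow> 'o \<Rightarrow> 'o \<Rightarrow> 'h \<Rightarrow> 'g"

locale dg_functor = source: dg_category K A + target: dg_category K B
  for K :: "'k ring"
    and A :: "('k, 'o, 'h) pre_dgcategory"
    and B :: "('k, 'p, 'g) pre_dgcategory" +
  fixes F :: "('o, 'h, 'p, 'g) pre_dgfunctor"
  assumes ob_map_closed: "x \<in> dgOb A \<Longrightarrow> dgob_map F x \<in> dgOb B"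
    and hom_map_closed:
      "\<lbrakk>x \<in> dgOb A; y \<in> dgOb A; f \<in> carrier (dgHom A i x y)\<rbrakk>
       \<Longrightarrow> dghom_map F i x y f \<in> carrier (dgHom B i (dgob_map F x) (dgob_map F y))"
    and map_add:
      "\<lbrakk>x \<in> dgOb A; y \<in> dgOb A; f \<in> carrier (dgHom A i x y); f' \<in> carrier (dgHom A i x y)\<rbrakk>
       \<Longrightarrow> dghom_map F i x y (f \<oplus>\<^bsub>dgHom A i x y\<^esub> f') =
           dghom_map F i x y f \<oplus>\<^bsub>dgHom B i (dgob_map F x) (dgob_map F y)\<^esub> dghom_map F i x y f'"
    and map_smult:
      "\<lbrakk>x \<in> dgOb A; y \<in> dgOb A; c \<in> carrier K; f \<in> carrier (dgHom A i x y)\<rbrakk>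
       \<Longrightarrow> dghom_map F i x y (c \<odot>\<^bsub>dgHom A i x y\<^esub> f) =
           c \<odot>\<^bsub>dgHom B i (dgob_map F x) (dgob_map F y)\<^esub> dghom_map F i x y f"
    and map_Id:
      "x \<in> dgOb A \<Longrightarrow> dghom_map F 0 x x (dgId A x) = dgId B (dgob_map F x)"
    and map_Comp:
      "\<lbrakk>x \<in> dgOb A; y \<in> dgOb A; z \<in> dgOb A;
        f \<in> carrier (dgHom A i x y); g \<in> carrier (dgHom A j y z)\<rbrakk>
       \<Longrightarrow> dghom_map F (j + i) x z (dgComp A j i x y z g f) =
           dgComp B j i (dgob_map F x) (dgob_map F y) (dgob_map F z)
             (dghom_map F j y z g) (dghom_map F i x y f)"
    and map_Diff:
      "\<lbrakk>x \<in> dgOb A; y \<in> dgOb A; f \<in> carrier (dgHom A i x y)\<rbrakk>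
       \<Longrightarrow> dghom_map F (i + 1) x y (dgDiff A i x y f) =
           dgDiff B i (dgob_map F x) (dgob_map F y) (dghom_map F i x y f)"

definition dgfunctor_restrict ::
  "('k, 'o, 'h) pre_dgcategory \<Rightarrow> ('o, 'h, 'p, 'g) pre_dgfunctor \<Rightarrow> ('o, 'h, 'p, 'g) pre_dgfunctor"
  where "dgfunctor_restrict A F =
    \<lparr>dgob_map = restrict (dgob_map F) (dgOb A),
     dghom_map = (\<lambda>i x y f.
       if x \<in> dgOb A \<and> y \<in> dgOb A \<and> f \<in> carrier (dgHom A i x y)
       then dghom_map F i x y f else undefined)\<rparr>"

definition dgfunctor_id :: "('o, 'h, 'o, 'h) pre_dgfunctor" where
  "dgfunctor_id = \<lparr>dgob_map = (\<lambda>x. x), dghom_map = (\<lambda>i x y f. f)\<rparr>"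

definition dgfunctor_comp ::
  "('p, 'g, 'q, 'l) pre_dgfunctor \<Rightarrow> ('o, 'h, 'p, 'g) pre_dgfunctor \<Rightarrow> ('o, 'h, 'q, 'l) pre_dgfunctor"
  where "dgfunctor_comp G F =
    \<lparr>dgob_map = dgob_map G \<circ> dgob_map F,
     dghom_map = (\<lambda>i x y f.
       dghom_map G i (dgob_map F x) (dgob_map F y) (dghom_map F i x y f))\<rparr>"

text \<open>The category of \<open>\<int>/2\<close>-graded dg-categories over \<open>K\<close>. The types \<^typ>\<open>'o\<close> and \<^typ>\<open>'h\<close> act as
  universes for objects and morphisms, which is the smallness condition. As in
  \<^const>\<open>Lambda\<close>, a morphism is a restricted functor with its source and target.\<close>

definition dgcat :: "'k ring \<Rightarrow>
    (('k, 'o, 'h) pre_dgcategory,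
     ('k, 'o, 'h) pre_dgcategory \<times> ('k, 'o, 'h) pre_dgcategory \<times> ('o, 'h, 'o, 'h) pre_dgfunctor)
    pre_category" where
  "dgcat K =
    \<lparr>Ob = {A. dg_category K A},
     Arr = {(A, B, F). dg_functor K A B F \<and> dgfunctor_restrict A F = F},
     Dom = (\<lambda>(A, B, F). A),
     Cod = (\<lambda>(A, B, F). B),
     Id = (\<lambda>A. (A, A, dgfunctor_restrict A dgfunctor_id)),
     Comp = (\<lambda>(B', C, G) (A, B, F). (A, C, dgfunctor_restrict A (dgfunctor_comp G F)))\<rparr>"

section \<open>The linear envelope\<close>

text \<open>A morphism \<open>x \<rightarrow> y\<close> of the \<open>k\<close>-linear envelope is a finite formal \<open>k\<close>-linear combination
  of arrows \<open>x \<rightarrow> y\<close>; composition and the action of functors are extended (bi)linearly.\<close>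

definition lin_Hom :: "('o, 'a, 'z) pre_category_scheme \<Rightarrow> 'o \<Rightarrow> 'o \<Rightarrow> ('a \<Rightarrow>\<^sub>0 'k::field) set" where
  "lin_Hom C x y = {p. Poly_Mapping.keys p \<subseteq> Hom C x y}"

definition lin_Comp :: "('o, 'a, 'z) pre_category_scheme \<Rightarrow>
    ('a \<Rightarrow>\<^sub>0 'k::field) \<Rightarrow> ('a \<Rightarrow>\<^sub>0 'k) \<Rightarrow> ('a \<Rightarrow>\<^sub>0 'k)" where
  "lin_Comp C q p = (\<Sum>b\<in>Poly_Mapping.keys q. \<Sum>a\<in>Poly_Mapping.keys p.
     Poly_Mapping.single (Comp C b a) (Poly_Mapping.lookup q b * Poly_Mapping.lookup p a))"

definition lin_map :: "('a \<Rightarrow> 'b) \<Rightarrow> ('a \<Rightarrow>\<^sub>0 'k::field) \<Rightarrow> ('b \<Rightarrow>\<^sub>0 'k)" where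
  "lin_map \<phi> p =
    (\<Sum>a\<in>Poly_Mapping.keys p. Poly_Mapping.single (\<phi> a) (Poly_Mapping.lookup p a))"

section \<open>Loop factorizations\<close>

record ('o, 'a) loop_factorization =
  x\<^sub>1 :: 'o
  x\<^sub>0 :: 'o
  phi :: 'a
  psi :: 'a

definition loop_factorizations ::
  "('o, 'a, 'z) pre_zcategory_scheme \<Rightarrow> ('o, 'a) loop_factorization set" where
  "loop_factorizations C =
    {F. x\<^sub>1 F \<in> Ob C \<and> x\<^sub>0 F \<in> Ob C \<and>
        phi F \<in> Hom C (x\<^sub>1 F) (x\<^sub>0 F) \<and> psi F \<in> Hom C (x\<^sub>0 F) (x\<^sub>1 F) \<and>
        Comp C (phi F) (psi F) = loop C (x\<^sub>0 F) \<and> Comp C (psi F) (phi F) = loop C (x\<^sub>1 F)}"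

definition lf_part :: "('o, 'a) loop_factorization \<Rightarrow> bit \<Rightarrow> 'o" where
  "lf_part F a = (if a = 0 then x\<^sub>0 F else x\<^sub>1 F)"

text \<open>A morphism \<open>h\<close> of degree \<open>i\<close> is a \<open>2 \<times> 2\<close> block matrix with at most one nonzero block in
  each row, so it is stored as the pair of its blocks indexed by the target: \<open>h a\<close> is the block
  \<open>x\<^bsub>a+i\<^esub> \<rightarrow> x'\<^bsub>a\<^esub>\<close>. Thus degree 0 is \<open>Hom(x\<^sub>0, x\<^sub>0') \<oplus> Hom(x\<^sub>1, x\<^sub>1')\<close> and degree 1 is
  \<open>Hom(x\<^sub>1, x\<^sub>0') \<oplus> Hom(x\<^sub>0, x\<^sub>1')\<close>.\<close>

definition lf_Hom :: "('o, 'a, 'z) pre_zcategory_scheme \<Rightarrow> bit \<Rightarrow>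
    ('o, 'a) loop_factorization \<Rightarrow> ('o, 'a) loop_factorization \<Rightarrow>
    ('k::field, bit \<Rightarrow> 'a \<Rightarrow>\<^sub>0 'k) module" where
  "lf_Hom C i F F' =
    \<lparr>carrier = {h. \<forall>a. h a \<in> lin_Hom C (lf_part F (a + i)) (lf_part F' a)},
     monoid.mult = undefined, monoid.one = undefined,
     ring.zero = (\<lambda>a. 0), ring.add = (\<lambda>g h a. g a + h a),
     module.smult = (\<lambda>c h a. Poly_Mapping.map ((*) c) (h a))\<rparr>"

text \<open>The product of the block matrices \<open>g\<close>, of degree \<open>j\<close>, and \<open>f\<close>.\<close>

definition lf_Comp :: "('o, 'a, 'z) pre_zcategory_scheme \<Rightarrow> bit \<Rightarrow>
    (bit \<Rightarrow> 'a \<Rightarrow>\<^sub>0 'k::field) \<Rightarrow> (bit \<Rightarrow> 'a \<Rightarrow>\<^sub>0 'k) \<Rightarrow> (bit \<Rightarrow> 'a \<Rightarrow>\<^sub>0 'k)" where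
  "lf_Comp C j g f = (\<lambda>a. lin_Comp C (g a) (f (a + j)))"

definition lf_Id :: "('o, 'a, 'z) pre_zcategory_scheme \<Rightarrow> ('o, 'a) loop_factorization \<Rightarrow>
    (bit \<Rightarrow> 'a \<Rightarrow>\<^sub>0 'k::field)" where
  "lf_Id C F = (\<lambda>a. Poly_Mapping.single (Id C (lf_part F a)) 1)"

definition lf_delta :: "('o, 'a) loop_factorization \<Rightarrow> (bit \<Rightarrow> 'a \<Rightarrow>\<^sub>0 'k::field)" where
  "lf_delta F = (\<lambda>a. Poly_Mapping.single (if a = 0 then phi F else psi F) 1)"

definition lf_Diff :: "('o, 'a, 'z) pre_zcategory_scheme \<Rightarrow> bit \<Rightarrow>
    ('o, 'a) loop_factorization \<Rightarrow> ('o, 'a) loop_factorization \<Rightarrow>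
    (bit \<Rightarrow> 'a \<Rightarrow>\<^sub>0 'k::field) \<Rightarrow> (bit \<Rightarrow> 'a \<Rightarrow>\<^sub>0 'k)" where
  "lf_Diff C i F F' h = (\<lambda>a.
     lf_Comp C 1 (lf_delta F') h a -
     (if i = 0 then lf_Comp C i h (lf_delta F) a else - lf_Comp C i h (lf_delta F) a))"

definition LF :: "('o, 'a, 'z) pre_zcategory_scheme \<Rightarrow>
    ('k::field, ('o, 'a) loop_factorization, bit \<Rightarrow> 'a \<Rightarrow>\<^sub>0 'k) pre_dgcategory" where
  "LF C =
    \<lparr>dgOb = loop_factorizations C,
     dgHom = lf_Hom C,
     dgId = lf_Id C,
     dgComp = (\<lambda>j i F F' F'' g f. lf_Comp C j g f),
     dgDiff = lf_Diff C\<rparr>"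

definition LF_map :: "('o, 'a, 'p, 'b) pre_functor \<Rightarrow>
    (('o, 'a) loop_factorization, bit \<Rightarrow> 'a \<Rightarrow>\<^sub>0 'k::field,
     ('p, 'b) loop_factorization, bit \<Rightarrow> 'b \<Rightarrow>\<^sub>0 'k) pre_dgfunctor" where
  "LF_map T =
    \<lparr>dgob_map = (\<lambda>F. \<lparr>x\<^sub>1 = ob_map T (x\<^sub>1 F), x\<^sub>0 = ob_map T (x\<^sub>0 F),
                      phi = arr_map T (phi F), psi = arr_map T (psi F)\<rparr>),
     dghom_map = (\<lambda>i F F' h a. lin_map (arr_map T) (h a))\<rparr>"

type_synonym 'k lf_dgcategory =
  "('k, (nat, nat \<times> nat list \<times> nat) loop_factorization,
    bit \<Rightarrow> (nat \<times> nat list \<times> nat) \<Rightarrow>\<^sub>0 'k) pre_dgcategory"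

type_synonym 'k lf_dgfunctor =
  "((nat, nat \<times> nat list \<times> nat) loop_factorization, bit \<Rightarrow> (nat \<times> nat list \<times> nat) \<Rightarrow>\<^sub>0 'k,
    (nat, nat \<times> nat list \<times> nat) loop_factorization, bit \<Rightarrow> (nat \<times> nat list \<times> nat) \<Rightarrow>\<^sub>0 'k)
   pre_dgfunctor"

definition EE :: "(nat, nat \<times> nat \<times> cyclic_functor,
    'k::field lf_dgcategory, 'k lf_dgcategory \<times> 'k lf_dgcategory \<times> 'k lf_dgfunctor) pre_functor" where
  "EE =
    \<lparr>ob_map = (\<lambda>n. LF (QQ n)),
     arr_map = (\<lambda>(m, n, T).
       (LF (QQ m), LF (QQ n), dgfunctor_restrict (LF (QQ m)) (LF_map T)))\<rparr>"

end

theory Submission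
  imports Defs
begin

text \<open>
  Taking loop factorizations is a strict functor from \<open>\<int>\<^sub>+\<close>-categories to \<open>\<int>/2\<close>-graded
  dg-categories, and Connes' category consists of the \<open>\<int>\<^sub>+\<close>-categories \<open>QQ n\<close> with all
  \<open>\<int>\<^sub>+\<close>-functors between them. The cocyclic object is the restriction of this functor.

  On objects, the point is that \<open>LF C\<close> is a dg-category for every \<open>\<int>\<^sub>+\<close>-category \<open>C\<close>. Its
  differential is the graded commutator with the odd endomorphism \<open>\<delta> = \<phi> + \<psi>\<close>, so that it is a
  derivation (\<open>lf_Leibniz\<close>); and it squares to the commutator with \<open>\<delta>\<^sup>2 = w\<close>, which vanishes
  because \<open>w\<close> is a natural transformation (\<open>lf_Diff_Diff\<close>). That \<open>QQ n\<close> is a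
  \<open>\<int>\<^sub>+\<close>-category (\<open>zcategory_QQ\<close>) holds because a walk in the circular quiver is determined by its
  start and its length, so that going once around the circle commutes with every walk.

  On morphisms, a \<open>\<int>\<^sub>+\<close>-functor maps factorizations of \<open>w\<close> to factorizations of \<open>w\<close>, and its linear
  extension respects composition and \<open>\<delta>\<close>, hence the differential (\<open>dg_functor_LF_map\<close>). Identities
  and composites are preserved on the nose (\<open>LF_map_id\<close>, \<open>LF_map_comp\<close>). Both in the cyclic
  category and in the category of dg-categories a morphism is a functor cut off outside its source,
  so it also has to be seen that the cut-offs do not interfere (\<open>LF_map_restrict\<close>,
  \<open>dgfunctor_comp_restrict_left\<close>, \<open>dgfunctor_comp_restrict_right\<close>).
\<close>

section \<open>The free category on a circular quiver\<close>

text \<open>The walk of length \<open>l\<close> that starts at \<open>u\<close>. Every vertex of the circular quiver is the tail of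
  exactly one arc, so there is no other walk with this start and this length.\<close>

definition walk_from :: "nat \<Rightarrow> nat \<Rightarrow> nat \<Rightarrow> nat list" where
  "walk_from n u l = map (\<lambda>k. (u + k) mod (n + 1)) [0..<l]"

lemma length_walk_from [simp]: "length (walk_from n u l) = l"
  by (simp add: walk_from_def)

lemma walk_from_add: "walk_from n u (l + m) = walk_from n u l @ walk_from n ((u + l) mod (n + 1)) m"
  by (rule nth_equalityI) (auto simp: walk_from_def nth_append mod_add_left_eq)

text \<open>The form that matches the recursion of \<^const>\<open>pre_digraph.cas\<close> along the first arc.\<close>

lemma walk_from_Suc: "u \<le> n \<Longrightarrow> walk_from n u (Suc l) = u # walk_from n ((u + 1) mod (n + 1)) l"
  using walk_from_add[of n u 1 l] by (simp add: walk_from_def)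

lemma cas_circular_quiver:
  assumes "u \<le> n"
  shows "pre_digraph.cas (circular_quiver n) u p v \<longleftrightarrow>
    p = walk_from n u (length p) \<and> v = (u + length p) mod (n + 1)"
  using assms
proof (induction p arbitrary: u)
  case Nil
  then show ?case by (auto simp: pre_digraph.cas.simps walk_from_def)
next
  case (Cons e p)
  have "(u + 1) mod (n + 1) \<le> n" by (simp add: less_Suc_eq_le[symmetric])
  note IH = Cons.IH[OF this]
  have "((u + 1) mod (n + 1) + length p) mod (n + 1) = (u + length (e # p)) mod (n + 1)"
    by (simp add: mod_add_left_eq mod_Suc_eq flip: add_Suc)
  then show ?case
    using IH walk_from_Suc[OF Cons.prems, of "length p"]
    by (auto simp: pre_digraph.cas.simps circular_quiver_def)
qed

lemma awalk_circular_quiver: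
  "pre_digraph.awalk (circular_quiver n) u p v \<longleftrightarrow>
    u \<le> n \<and> p = walk_from n u (length p) \<and> v = (u + length p) mod (n + 1)"
proof -
  have "set (walk_from n u l) \<subseteq> {0..n}" for l
    by (auto simp: walk_from_def less_Suc_eq_le[symmetric])
  then show ?thesis
    using cas_circular_quiver[of u n p v]
    by (auto simp: pre_digraph.awalk_def circular_quiver_def) (metis atLeastAtMost_iff subsetD)
qed

lemma QQ_simps:
  "Ob (QQ n) = {0..n}"
  "Arr (QQ n) = {(u, p, v). u \<le> n \<and> p = walk_from n u (length p) \<and> v = (u + length p) mod (n + 1)}"
  "Dom (QQ n) f = fst f"
  "Cod (QQ n) f = snd (snd f)"
  "Id (QQ n) u = (u, [], u)"
  "Comp (QQ n) g f = (fst f, fst (snd f) @ fst (snd g), snd (snd g))"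
  "loop (QQ n) u = (u, walk_from n u (n + 1), u)"
  by (simp_all add: QQ_def free_category_def walk_from_def[of n u] pre_category.defs
      pre_zcategory.defs case_prod_beta awalk_circular_quiver, simp_all add: circular_quiver_def)

lemma Hom_QQ:
  "Hom (QQ n) u v = {(u, walk_from n u l, v) |l. u \<le> n \<and> v = (u + l) mod (n + 1)}"
  by (auto simp: Hom_def QQ_simps)

lemma full_turn: "u \<le> (n::nat) \<Longrightarrow> (u + (n + 1)) mod (n + 1) = u"
  by (simp only: mod_add_self2) simp

text \<open>The loops commute with every arrow \<open>x \<rightarrow> y\<close> of length \<open>l\<close> because both composites are walks
  from \<open>x\<close> of length \<open>l + n + 1\<close>, and a walk is determined by its start and its length.\<close>

lemma zcategory_QQ: "zcategory (QQ n)"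
proof
  show "Comp (QQ n) g f \<in> Hom (QQ n) x z"
    if "f \<in> Hom (QQ n) x y" and "g \<in> Hom (QQ n) y z" for f g x y z
  proof -
    from that obtain l m where f: "f = (x, walk_from n x l, y)" and x: "x \<le> n"
      and y: "y = (x + l) mod (n + 1)" and g: "g = (y, walk_from n y m, z)"
      and z: "z = (y + m) mod (n + 1)" by (auto simp: Hom_QQ)
    have "z = (x + (l + m)) mod (n + 1)"
      by (simp only: z y mod_add_left_eq add.assoc)
    moreover have "walk_from n x l @ walk_from n y m = walk_from n x (l + m)"
      by (simp only: y walk_from_add)
    ultimately show ?thesis
      using x unfolding Hom_QQ f g QQ_simps by auto
  qed
  show "Comp (QQ n) f (loop (QQ n) x) = Comp (QQ n) (loop (QQ n) y) f"
    if "f \<in> Hom (QQ n) x y" for f x y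
  proof -
    from that obtain l where f: "f = (x, walk_from n x l, y)" and x: "x \<le> n"
      and y: "y = (x + l) mod (n + 1)" by (auto simp: Hom_QQ)
    have "walk_from n x (n + 1) @ walk_from n x l = walk_from n x (l + (n + 1))"
      using walk_from_add[of n x "n + 1" l] by (simp only: full_turn[OF x] add.commute[of l])
    also have "\<dots> = walk_from n x l @ walk_from n y (n + 1)"
      by (simp only: y walk_from_add)
    finally show ?thesis by (simp add: f QQ_simps)
  qed
  show "loop (QQ n) x \<in> Hom (QQ n) x x" if "x \<in> Ob (QQ n)" for x
    using that full_turn[of x n] by (simp add: Hom_def QQ_simps)
qed (auto simp: Hom_def QQ_simps less_Suc_eq_le[symmetric], auto simp: walk_from_def)

section \<open>The linear envelope\<close>

abbreviation scale :: "'k::field \<Rightarrow> ('a \<Rightarrow>\<^sub>0 'k) \<Rightarrow> ('a \<Rightarrow>\<^sub>0 'k)" where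
  "scale c \<equiv> Poly_Mapping.map ((*) c)"

lemma lookup_scale: "Poly_Mapping.lookup (scale c p) a = c * Poly_Mapping.lookup p a"
  by (simp add: Poly_Mapping.map.rep_eq when_def)

lemma scale_0 [simp]: "scale c 0 = 0"
  by (rule poly_mapping_eqI) (simp add: lookup_scale)

lemma scale_add: "scale c (p + q) = scale c p + scale c q"
  by (rule poly_mapping_eqI) (simp add: lookup_scale lookup_add algebra_simps)

lemma scale_add_left: "scale (c + d) p = scale c p + scale d p"
  by (rule poly_mapping_eqI) (simp add: lookup_scale lookup_add algebra_simps)

lemma scale_minus: "scale c (- p) = - scale c p"
  by (rule poly_mapping_eqI) (simp add: lookup_scale)

lemma scale_diff: "scale c (p - q) = scale c p - scale c q"
  by (rule poly_mapping_eqI) (simp add: lookup_scale lookup_minus algebra_simps)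

lemma scale_scale: "scale (c * d) p = scale c (scale d p)"
  by (rule poly_mapping_eqI) (simp add: lookup_scale)

lemma scale_one: "scale 1 p = p"
  by (rule poly_mapping_eqI) (simp add: lookup_scale)

lemma scale_single: "scale c (Poly_Mapping.single a d) = Poly_Mapping.single a (c * d)"
  by (rule poly_mapping_eqI) (simp add: lookup_scale lookup_single when_def)

text \<open>Finite combinations of elements of \<open>A\<close> are spanned by monomials, so an identity between additive
  expressions needs to be checked on monomials only; this is how structure on arrows is
  transported to the linear envelope.\<close>

lemma combination_induct [consumes 1, case_names zero single add]:
  fixes p :: "'a \<Rightarrow>\<^sub>0 'k::comm_monoid_add"
  assumes "Poly_Mapping.keys p \<subseteq> A"
    and zero: "P 0"
    and single: "\<And>a c. a \<in> A \<Longrightarrow> P (Poly_Mapping.single a c)"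
    and add: "\<And>p q. P p \<Longrightarrow> P q \<Longrightarrow> P (p + q)"
  shows "P p"
proof -
  have "P (\<Sum>a\<in>S. Poly_Mapping.single a (Poly_Mapping.lookup p a))"
    if "finite S" "S \<subseteq> A" for S
    using that by (induction S rule: finite_induct) (auto intro: single add zero)
  moreover have "(\<Sum>a\<in>Poly_Mapping.keys p. Poly_Mapping.single a (Poly_Mapping.lookup p a)) = p"
    by (rule poly_mapping_eqI)
      (auto simp: lookup_sum lookup_single when_def sum.delta in_keys_iff)
  ultimately show ?thesis
    using assms(1) by (metis finite_keys)
qed

lemma lin_map_add: "lin_map \<phi> (p + q) = lin_map \<phi> p + lin_map \<phi> q"
  unfolding lin_map_def
  by (rule setsum_keys_plus_distrib) (simp_all add: single_add)

lemma lin_map_0 [simp]: "lin_map \<phi> 0 = 0"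
  by (simp add: lin_map_def)

lemma lin_map_single [simp]: "lin_map \<phi> (Poly_Mapping.single a c) = Poly_Mapping.single (\<phi> a) c"
  by (simp add: lin_map_def)

lemma lin_map_uminus: "lin_map \<phi> (- p) = - lin_map \<phi> p"
  using lin_map_add[of \<phi> "- p" p] by (simp add: eq_neg_iff_add_eq_0)

lemma lin_map_diff: "lin_map \<phi> (p - q) = lin_map \<phi> p - lin_map \<phi> q"
  using lin_map_add[of \<phi> p "- q"] by (simp add: lin_map_uminus)

lemma lin_map_scale: "lin_map \<phi> (scale c p) = scale c (lin_map \<phi> p)"
  by (induction p rule: combination_induct[OF subset_UNIV]) (simp_all add: scale_add scale_single lin_map_add)

lemma lin_map_cong:
  "(\<And>a. a \<in> Poly_Mapping.keys p \<Longrightarrow> \<phi> a = \<psi> a) \<Longrightarrow> lin_map \<phi> p = lin_map \<psi> p"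
  by (simp add: lin_map_def)

lemma lin_map_ident: "lin_map (\<lambda>a. a) p = p"
  by (induction p rule: combination_induct[OF subset_UNIV]) (simp_all add: lin_map_add)

lemma lin_map_lin_map: "lin_map \<phi> (lin_map \<psi> p) = lin_map (\<lambda>a. \<phi> (\<psi> a)) p"
  by (induction p rule: combination_induct[OF subset_UNIV]) (simp_all add: lin_map_add)

text \<open>Bilinearity holds for all formal combinations of arrows, composable or not; composability enters
  only in the category laws further down.\<close>

lemma lin_Comp_add_left: "lin_Comp C (q + q') p = lin_Comp C q p + lin_Comp C q' p"
  unfolding lin_Comp_def
  by (rule setsum_keys_plus_distrib[where f = "\<lambda>b d. \<Sum>a\<in>Poly_Mapping.keys p.
      Poly_Mapping.single (Comp C b a) (d * Poly_Mapping.lookup p a)"])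
    (simp_all add: distrib_right single_add sum.distrib)

lemma lin_Comp_add_right: "lin_Comp C q (p + p') = lin_Comp C q p + lin_Comp C q p'"
  \<comment> \<open>The outer sum must run over the argument in which additivity is claimed.\<close>
  unfolding lin_Comp_def sum.swap[of _ _ "Poly_Mapping.keys q"]
  by (rule setsum_keys_plus_distrib[where f = "\<lambda>a c. \<Sum>b\<in>Poly_Mapping.keys q.
      Poly_Mapping.single (Comp C b a) (Poly_Mapping.lookup q b * c)"])
    (simp_all add: distrib_left single_add sum.distrib)

lemma lin_Comp_0 [simp]: "lin_Comp C 0 p = 0" "lin_Comp C q 0 = 0"
  by (simp_all add: lin_Comp_def)

lemma lin_Comp_single [simp]:
  "lin_Comp C (Poly_Mapping.single b d) (Poly_Mapping.single a c) =
    Poly_Mapping.single (Comp C b a) (d * c)"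
  by (simp add: lin_Comp_def)

lemma lin_Comp_uminus_left: "lin_Comp C (- q) p = - lin_Comp C q p"
  using lin_Comp_add_left[of C "- q" q p] by (simp add: eq_neg_iff_add_eq_0)

lemma lin_Comp_uminus_right: "lin_Comp C q (- p) = - lin_Comp C q p"
  using lin_Comp_add_right[of C q "- p" p] by (simp add: eq_neg_iff_add_eq_0)

lemma lin_Comp_diff_left: "lin_Comp C (q - q') p = lin_Comp C q p - lin_Comp C q' p"
  using lin_Comp_add_left[of C q "- q'" p] by (simp add: lin_Comp_uminus_left)

lemma lin_Comp_diff_right: "lin_Comp C q (p - p') = lin_Comp C q p - lin_Comp C q p'"
  using lin_Comp_add_right[of C q p "- p'"] by (simp add: lin_Comp_uminus_right)

lemma lin_Comp_scale_left: "lin_Comp C (scale c q) p = scale c (lin_Comp C q p)"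
proof (induction p rule: combination_induct[OF subset_UNIV])
  case (2 a d)
  show ?case
    by (induction q rule: combination_induct[OF subset_UNIV])
      (simp_all add: scale_add scale_single lin_Comp_add_left mult.assoc)
qed (simp_all add: scale_add lin_Comp_add_right)

lemma lin_Comp_scale_right: "lin_Comp C q (scale c p) = scale c (lin_Comp C q p)"
proof (induction p rule: combination_induct[OF subset_UNIV])
  case (2 a d)
  show ?case
    by (induction q rule: combination_induct[OF subset_UNIV])
      (simp_all add: scale_add scale_single lin_Comp_add_left mult.left_commute)
qed (simp_all add: scale_add lin_Comp_add_right)

lemmas lin_Comp_bilinear =
  lin_Comp_add_left lin_Comp_add_right lin_Comp_diff_left lin_Comp_diff_right
  lin_Comp_uminus_left lin_Comp_uminus_right lin_Comp_scale_left lin_Comp_scale_right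

lemma lin_Hom_0 [simp]: "0 \<in> lin_Hom C x y"
  by (simp add: lin_Hom_def)

lemma lin_Hom_add: "p \<in> lin_Hom C x y \<Longrightarrow> q \<in> lin_Hom C x y \<Longrightarrow> p + q \<in> lin_Hom C x y"
  using keys_add[of p q] by (auto simp: lin_Hom_def)

lemma lin_Hom_uminus: "p \<in> lin_Hom C x y \<Longrightarrow> - p \<in> lin_Hom C x y"
  by (simp add: lin_Hom_def)

lemma lin_Hom_diff: "p \<in> lin_Hom C x y \<Longrightarrow> q \<in> lin_Hom C x y \<Longrightarrow> p - q \<in> lin_Hom C x y"
  using lin_Hom_add[of p C x y "- q"] by (simp add: lin_Hom_uminus)

lemma lin_Hom_scale: "p \<in> lin_Hom C x y \<Longrightarrow> scale c p \<in> lin_Hom C x y"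
  by (auto simp: lin_Hom_def in_keys_iff lookup_scale subset_iff)

lemma lin_Hom_single: "a \<in> Hom C x y \<Longrightarrow> Poly_Mapping.single a c \<in> lin_Hom C x y"
  by (simp add: lin_Hom_def)

lemma lin_Hom_induct [consumes 1, case_names zero single add]:
  assumes "p \<in> lin_Hom C x y"
    and "P 0"
    and "\<And>a c. a \<in> Hom C x y \<Longrightarrow> P (Poly_Mapping.single a c)"
    and "\<And>p q. P p \<Longrightarrow> P q \<Longrightarrow> P (p + q)"
  shows "P p"
  using assms combination_induct[of p "Hom C x y" P] by (auto simp: lin_Hom_def)

lemma (in category) lin_Comp_closed:
  assumes "p \<in> lin_Hom C x y" and "q \<in> lin_Hom C y z"
  shows "lin_Comp C q p \<in> lin_Hom C x z"
  using assms(1)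
proof (induction rule: lin_Hom_induct)
  case (single a c)
  show ?case
    using assms(2)
    by (induction rule: lin_Hom_induct)
      (auto simp: lin_Comp_add_left intro: lin_Hom_add lin_Hom_single Comp_closed single)
qed (auto simp: lin_Comp_add_right intro: lin_Hom_add)

lemma (in category) lin_Comp_Id:
  "p \<in> lin_Hom C x y \<Longrightarrow> lin_Comp C p (Poly_Mapping.single (Id C x) 1) = p"
  by (induction rule: lin_Hom_induct) (simp_all add: lin_Comp_add_left Comp_Id)

lemma (in category) lin_Id_Comp:
  "p \<in> lin_Hom C x y \<Longrightarrow> lin_Comp C (Poly_Mapping.single (Id C y) 1) p = p"
  by (induction rule: lin_Hom_induct) (simp_all add: lin_Comp_add_right Id_Comp)

text \<open>The combinations are reduced to monomials one after the other, from the innermost factor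
  outwards; on three monomials the claim is associativity in the category and in the field.\<close>

lemma (in category) lin_Comp_assoc:
  assumes p: "p \<in> lin_Hom C w x" and q: "q \<in> lin_Hom C x y" and r: "r \<in> lin_Hom C y z"
  shows "lin_Comp C (lin_Comp C r q) p = lin_Comp C r (lin_Comp C q p)"
  using p
proof (induction rule: lin_Hom_induct)
  case (single a c)
  note a = this
  show ?case
    using q
  proof (induction rule: lin_Hom_induct)
    case (single b d)
    show ?case
      using r
      by (induction rule: lin_Hom_induct)
        (simp_all add: lin_Comp_add_left Comp_assoc[OF a single] mult.assoc)
  qed (simp_all add: lin_Comp_add_left lin_Comp_add_right)
qed (simp_all add: lin_Comp_add_right)

text \<open>This is the centrality of the curvature \<open>w\<close> on which the vanishing of the squared
  differential rests.\<close>

lemma (in zcategory) lin_loop_natural: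
  "p \<in> lin_Hom C x y \<Longrightarrow>
    lin_Comp C p (Poly_Mapping.single (loop C x) 1) = lin_Comp C (Poly_Mapping.single (loop C y) 1) p"
  by (induction rule: lin_Hom_induct)
    (simp_all add: lin_Comp_add_left lin_Comp_add_right loop_natural)

lemma (in cat_functor) lin_map_closed:
  "p \<in> lin_Hom C x y \<Longrightarrow> lin_map (arr_map F) p \<in> lin_Hom D (ob_map F x) (ob_map F y)"
  by (induction rule: lin_Hom_induct)
    (auto simp: lin_map_add intro: lin_Hom_add lin_Hom_single arr_map_closed)

lemma (in cat_functor) lin_map_Comp:
  assumes p: "p \<in> lin_Hom C x y" and q: "q \<in> lin_Hom C y z"
  shows "lin_map (arr_map F) (lin_Comp C q p) =
    lin_Comp D (lin_map (arr_map F) q) (lin_map (arr_map F) p)"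
  using p
proof (induction rule: lin_Hom_induct)
  case (single a c)
  show ?case
    using q
    by (induction rule: lin_Hom_induct)
      (simp_all add: lin_map_add lin_Comp_add_left map_Comp[OF single])
qed (simp_all add: lin_map_add lin_Comp_add_right)

section \<open>Loop factorizations form a dg-category\<close>

text \<open>Degrees are to be treated as elements of the group \<open>\<int>/2\<close>: rewriting their sums to bit operations
  would hide the block indices \<open>a + i\<close> from the lemmas below.\<close>

declare add_bit_eq_xor [simp del]

text \<open>The Koszul sign \<open>(-1)\<^sup>i\<close>. As an operator that commutes with all additive maps, it lets the
  identities of dg-categories be proved for all degrees at once, without a case distinction.\<close>

definition koszul :: "bit \<Rightarrow> 'm::ab_group_add \<Rightarrow> 'm" where
  "koszul i p = (if i = 0 then p else - p)"

lemma koszul_add_degree: "koszul (i + j) p = koszul i (koszul j p)"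
  by (cases i; cases j) (simp_all add: koszul_def)

lemma koszul_one [simp]: "koszul 1 p = - p"
  by (simp add: koszul_def)

lemma koszul_diff: "koszul i (p - q) = koszul i p - koszul i q"
  by (simp add: koszul_def)

lemma koszul_plus: "koszul i (p + q) = koszul i p + koszul i q"
  by (simp add: koszul_def)

lemma koszul_uminus: "koszul i (- p) = - koszul i p"
  by (simp add: koszul_def)

lemma koszul_koszul [simp]: "koszul i (koszul i p) = p"
  by (simp add: koszul_def)

lemma lin_Comp_koszul:
  "lin_Comp C (koszul i q) p = koszul i (lin_Comp C q p)"
  "lin_Comp C q (koszul i p) = koszul i (lin_Comp C q p)"
  by (simp_all add: koszul_def lin_Comp_bilinear)

lemma koszul_scale: "koszul i (scale c p) = scale c (koszul i p)"
  by (simp add: koszul_def scale_minus)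

lemma lin_map_koszul: "lin_map \<phi> (koszul i p) = koszul i (lin_map \<phi> p)"
  by (simp add: koszul_def lin_map_uminus)

lemma lin_Hom_koszul: "p \<in> lin_Hom C x y \<Longrightarrow> koszul i p \<in> lin_Hom C x y"
  by (simp add: koszul_def lin_Hom_uminus)

lemma lf_Hom_simps:
  "h \<in> carrier (lf_Hom C i F F') \<longleftrightarrow> (\<forall>a. h a \<in> lin_Hom C (lf_part F (a + i)) (lf_part F' a))"
  "\<zero>\<^bsub>lf_Hom C i F F'\<^esub> = (\<lambda>a. 0)"
  "g \<oplus>\<^bsub>lf_Hom C i F F'\<^esub> h = (\<lambda>a. g a + h a)"
  "c \<odot>\<^bsub>lf_Hom C i F F'\<^esub> h = (\<lambda>a. scale c (h a))"
  by (simp_all add: lf_Hom_def)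

lemma LF_simps:
  "dgOb (LF C) = loop_factorizations C"
  "dgHom (LF C) = lf_Hom C"
  "dgId (LF C) = lf_Id C"
  "dgComp (LF C) j i F F' F'' g f = lf_Comp C j g f"
  "dgDiff (LF C) = lf_Diff C"
  by (simp_all add: LF_def)

lemma ring_of_type_algebra_simps:
  fixes a b :: "'k::field"
  shows "a \<in> carrier ring_of_type_algebra"
    "a \<oplus>\<^bsub>ring_of_type_algebra\<^esub> b = a + b"
    "a \<otimes>\<^bsub>ring_of_type_algebra\<^esub> b = a * b"
    "\<one>\<^bsub>ring_of_type_algebra\<^esub> = (1 :: 'k)"
  by (simp_all add: ring_of_type_algebra_def)

lemma module_lf_Hom:
  "Module.module (ring_of_type_algebra :: 'k ring)
    (lf_Hom C i F F' :: ('k::field, bit \<Rightarrow> 'a \<Rightarrow>\<^sub>0 'k) module)"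
proof (rule moduleI)
  show "cring (ring_of_type_algebra :: 'k ring)" ..
  show "abelian_group (lf_Hom C i F F' :: ('k, bit \<Rightarrow> 'a \<Rightarrow>\<^sub>0 'k) module)"
  proof (rule abelian_groupI)
    fix h :: "bit \<Rightarrow> 'a \<Rightarrow>\<^sub>0 'k"
    assume "h \<in> carrier (lf_Hom C i F F')"
    then show "\<exists>g\<in>carrier (lf_Hom C i F F'). g \<oplus>\<^bsub>lf_Hom C i F F'\<^esub> h = \<zero>\<^bsub>lf_Hom C i F F'\<^esub>"
      by (intro bexI[of _ "\<lambda>a. - h a"]) (auto simp: lf_Hom_simps lin_Hom_uminus)
  qed (auto simp: lf_Hom_simps lin_Hom_add add_ac)
qed (auto simp: lf_Hom_simps ring_of_type_algebra_simps lin_Hom_scale scale_add scale_add_left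
    scale_scale scale_one)

lemma lf_Hom_uminus:
  assumes "h \<in> carrier (lf_Hom C i F F')"
  shows "\<ominus>\<^bsub>lf_Hom C i F F'\<^esub> h = (\<lambda>a. - h a)"
proof -
  interpret Module.module ring_of_type_algebra "lf_Hom C i F F'"
    by (rule module_lf_Hom)
  show ?thesis
    by (rule minus_equality) (use assms in \<open>auto simp: lf_Hom_simps lin_Hom_uminus\<close>)
qed

lemma lf_Diff_apply:
  "lf_Diff C i F F' h a =
    lin_Comp C (lf_delta F' a) (h (a + 1)) - koszul i (lin_Comp C (h a) (lf_delta F (a + i)))"
  by (simp add: lf_Diff_def lf_Comp_def koszul_def)

lemma bit_add_one_one [simp]: "a + 1 + 1 = (a :: bit)"
  by (simp add: add.assoc)

lemma lf_delta_closed: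
  assumes "F \<in> loop_factorizations C"
  shows "lf_delta F a \<in> lin_Hom C (lf_part F (a + 1)) (lf_part F a)"
  using assms by (cases a) (auto simp: lf_delta_def lf_part_def loop_factorizations_def
      intro: lin_Hom_single)

text \<open>The square of the odd endomorphism is the curvature: the two equations in the definition of a
  loop factorization are the two diagonal blocks of \<open>\<delta>\<^sup>2 = w\<close>.\<close>

lemma lf_delta_delta:
  assumes "F \<in> loop_factorizations C"
  shows "lin_Comp C (lf_delta F a) (lf_delta F (a + 1)) =
    Poly_Mapping.single (loop C (lf_part F a)) 1"
  using assms by (cases a) (auto simp: lf_delta_def lf_part_def loop_factorizations_def)

lemma lf_part_closed: "F \<in> loop_factorizations C \<Longrightarrow> lf_part F a \<in> Ob C"
  by (auto simp: loop_factorizations_def lf_part_def)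

context zcategory
begin

text \<open>The mixed terms \<open>\<delta>' h \<delta>\<close> occur twice, with opposite signs. What remains is
  \<open>\<delta>'\<^sup>2 h - h \<delta>\<^sup>2 = w h - h w\<close>, which vanishes since \<open>w\<close> is natural.\<close>

lemma lf_Diff_Diff:
  assumes F: "F \<in> loop_factorizations C" and F': "F' \<in> loop_factorizations C"
    and h: "h \<in> carrier (lf_Hom C i F F')"
  shows "lf_Diff C (i + 1) F F' (lf_Diff C i F F' h) = (\<lambda>a. 0)"
proof
  fix a
  let ?d = "lf_delta F" and ?d' = "lf_delta F'"
  have h: "h b \<in> lin_Hom C (lf_part F (b + i)) (lf_part F' b)" for b
    using h by (simp add: lf_Hom_simps)
  have h1: "h (a + 1) \<in> lin_Hom C (lf_part F (a + i + 1)) (lf_part F' (a + 1))"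
    using h[of "a + 1"] by (simp add: ac_simps)
  have d: "?d (a + i) \<in> lin_Hom C (lf_part F (a + i + 1)) (lf_part F (a + i))"
    "?d (a + i + 1) \<in> lin_Hom C (lf_part F (a + i)) (lf_part F (a + i + 1))"
    using lf_delta_closed[OF F, of "a + i"] lf_delta_closed[OF F, of "a + i + 1"] by simp_all
  have d': "?d' a \<in> lin_Hom C (lf_part F' (a + 1)) (lf_part F' a)"
    "?d' (a + 1) \<in> lin_Hom C (lf_part F' a) (lf_part F' (a + 1))"
    using lf_delta_closed[OF F', of a] lf_delta_closed[OF F', of "a + 1"] by simp_all
  have "lin_Comp C (?d' a) (lin_Comp C (?d' (a + 1)) (h a)) =
      lin_Comp C (Poly_Mapping.single (loop C (lf_part F' a)) 1) (h a)"
    using lin_Comp_assoc[OF h d'(2) d'(1)] by (simp add: lf_delta_delta[OF F'])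
  also have "\<dots> = lin_Comp C (h a) (Poly_Mapping.single (loop C (lf_part F (a + i))) 1)"
    using lin_loop_natural[OF h] by simp
  also have "\<dots> = lin_Comp C (lin_Comp C (h a) (?d (a + i))) (?d (a + i + 1))"
    using lin_Comp_assoc[OF d(2) d(1) h] by (simp add: lf_delta_delta[OF F])
  finally have square: "lin_Comp C (?d' a) (lin_Comp C (?d' (a + 1)) (h a)) =
      lin_Comp C (lin_Comp C (h a) (?d (a + i))) (?d (a + i + 1))" .
  have mixed: "lin_Comp C (lin_Comp C (?d' a) (h (a + 1))) (?d (a + i + 1)) =
      lin_Comp C (?d' a) (lin_Comp C (h (a + 1)) (?d (a + i + 1)))"
    by (rule lin_Comp_assoc[OF d(2) h1 d'(1)])
  \<comment> \<open>The block index arises in several bracketings, depending on which factor it passes first.\<close>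
  have shift: "a + 1 + i = a + i + 1" "a + (i + 1) = a + i + 1"
    by (simp_all add: ac_simps)
  show "lf_Diff C (i + 1) F F' (lf_Diff C i F F' h) a = 0"
    by (simp add: lf_Diff_apply shift koszul_add_degree lin_Comp_bilinear lin_Comp_koszul
        koszul_diff koszul_uminus square mixed)
qed

text \<open>The differential is a graded commutator with \<open>\<delta>\<close>: expanding \<open>(d g) f \<plusminus> g (d f)\<close>, the two terms
  \<open>g \<delta>' f\<close> cancel and the two outer ones are \<open>d (g f)\<close>.\<close>

lemma lf_Leibniz:
  assumes F: "F \<in> loop_factorizations C" and F': "F' \<in> loop_factorizations C"
    and F'': "F'' \<in> loop_factorizations C"
    and f: "f \<in> carrier (lf_Hom C i F F')" and g: "g \<in> carrier (lf_Hom C j F' F'')"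
  shows "lf_Diff C (j + i) F F'' (lf_Comp C j g f) a =
    lf_Comp C (j + 1) (lf_Diff C j F' F'' g) f a + koszul j (lf_Comp C j g (lf_Diff C i F F' f) a)"
proof -
  let ?d = "lf_delta F" and ?d' = "lf_delta F'" and ?d'' = "lf_delta F''"
  have f0: "f (a + j) \<in> lin_Hom C (lf_part F (a + j + i)) (lf_part F' (a + j))"
    and f1: "f (a + j + 1) \<in> lin_Hom C (lf_part F (a + j + i + 1)) (lf_part F' (a + j + 1))"
    and g0: "g a \<in> lin_Hom C (lf_part F' (a + j)) (lf_part F'' a)"
    and g1: "g (a + 1) \<in> lin_Hom C (lf_part F' (a + j + 1)) (lf_part F'' (a + 1))"
    using f[unfolded lf_Hom_simps, rule_format, of "a + j"]
      f[unfolded lf_Hom_simps, rule_format, of "a + j + 1"]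
      g[unfolded lf_Hom_simps, rule_format, of "a"]
      g[unfolded lf_Hom_simps, rule_format, of "a + 1"]
    by (simp_all add: ac_simps)
  note assoc =
    lin_Comp_assoc[OF f1 g1 lf_delta_closed[OF F'', of a]]
    lin_Comp_assoc[OF f1 lf_delta_closed[OF F', of "a + j"] g0]
    lin_Comp_assoc[OF lf_delta_closed[OF F, of "a + j + i"] f0 g0]
  have shift: "a + 1 + j = a + j + 1" "a + (j + 1) = a + j + 1" "a + (j + i) = a + j + i"
    by (simp_all add: ac_simps)
  show ?thesis
    by (simp add: lf_Diff_apply lf_Comp_def shift koszul_add_degree lin_Comp_bilinear
        lin_Comp_koszul koszul_diff assoc)
qed

lemma lf_Comp_closed:
  assumes "f \<in> carrier (lf_Hom C i F F')" and "g \<in> carrier (lf_Hom C j F' F'')"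
  shows "lf_Comp C j g f \<in> carrier (lf_Hom C (j + i) F F'')"
  using assms by (auto simp: lf_Hom_simps lf_Comp_def simp flip: add.assoc intro!: lin_Comp_closed)

lemma lf_Diff_closed:
  assumes F: "F \<in> loop_factorizations C" and F': "F' \<in> loop_factorizations C"
    and h: "h \<in> carrier (lf_Hom C i F F')"
  shows "lf_Diff C i F F' h \<in> carrier (lf_Hom C (i + 1) F F')"
  unfolding lf_Hom_simps
proof
  fix a
  have "h (a + 1) \<in> lin_Hom C (lf_part F (a + (i + 1))) (lf_part F' (a + 1))"
    and "h a \<in> lin_Hom C (lf_part F (a + i)) (lf_part F' a)"
    using h[unfolded lf_Hom_simps, rule_format, of "a + 1"]
      h[unfolded lf_Hom_simps, rule_format, of a] by (simp_all add: ac_simps)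
  moreover have "lf_delta F (a + i) \<in> lin_Hom C (lf_part F (a + (i + 1))) (lf_part F (a + i))"
    using lf_delta_closed[OF F, of "a + i"] by (simp add: ac_simps)
  ultimately show "lf_Diff C i F F' h a \<in> lin_Hom C (lf_part F (a + (i + 1))) (lf_part F' a)"
    unfolding lf_Diff_apply
    by (intro lin_Hom_diff lin_Hom_koszul lin_Comp_closed) (auto intro: lf_delta_closed[OF F'])
qed

text \<open>Cases 14 and 15 are the vanishing of the squared differential and the Leibniz rule; the other
  axioms hold blockwise in the linear envelope.\<close>

lemma dg_category_LF: "dg_category (ring_of_type_algebra :: 'k::field ring) (LF C)"
proof (rule dg_category.intro, unfold LF_simps, goal_cases)
  case (1 x y i)
  then show ?case by (rule_tac module_lf_Hom)
next
  case (2 x)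
  then show ?case
    by (auto simp: lf_Hom_simps lf_Id_def intro: lin_Hom_single Id_closed lf_part_closed)
next
  case (3 x y z f i g j)
  then show ?case by (rule_tac lf_Comp_closed)
next
  case (8 x y f i)
  then show ?case
    by (auto simp: lf_Comp_def lf_Id_def lf_Hom_simps intro!: ext lin_Comp_Id)
next
  case (9 x y f i)
  then show ?case
    by (auto simp: lf_Comp_def lf_Id_def lf_Hom_simps intro!: ext lin_Id_Comp)
next
  case (10 w x y z f i g j h l)
  show ?case
  proof
    fix a
    have "f (a + l + j) \<in> lin_Hom C (lf_part w (a + l + j + i)) (lf_part x (a + l + j))"
      "g (a + l) \<in> lin_Hom C (lf_part x (a + l + j)) (lf_part y (a + l))"
      "h a \<in> lin_Hom C (lf_part y (a + l)) (lf_part z a)"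
      using 10 by (auto simp: lf_Hom_simps)
    from lin_Comp_assoc[OF this]
    show "lf_Comp C (l + j) (lf_Comp C l h g) f a = lf_Comp C l h (lf_Comp C j g f) a"
      by (simp add: lf_Comp_def add.assoc)
  qed
next
  case (11 x y f i)
  then show ?case by (rule_tac lf_Diff_closed)
next
  case (14 x y f i)
  then show ?case by (simp add: lf_Diff_Diff lf_Hom_simps)
next
  case (15 x y z f i g j)
  have "lf_Comp C j g (lf_Diff C i x y f) \<in> carrier (lf_Hom C (j + i + 1) x z)"
    using lf_Comp_closed[OF lf_Diff_closed[OF 15(1,2,4)] 15(5)] by (simp add: add.assoc)
  note minus = lf_Hom_uminus[OF this]
  show ?case
    unfolding minus Let_def using lf_Leibniz[OF 15]
    by (simp add: fun_eq_iff lf_Hom_simps koszul_def)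
qed (auto simp: lf_Hom_simps lf_Comp_def lf_Diff_apply lin_Comp_bilinear koszul_plus koszul_scale scale_diff intro!: ext)

end

section \<open>Functoriality of loop factorizations\<close>

text \<open>This is where the dg-functor needs that loops are respected: the factorizations of \<open>w\<close> in the source
  must become factorizations of \<open>w\<close> in the target.\<close>

lemma (in zfunctor) dgob_map_LF_map:
  "x \<in> loop_factorizations C \<Longrightarrow> dgob_map (LF_map F) x \<in> loop_factorizations D"
  by (auto simp: LF_map_def loop_factorizations_def ob_map_closed arr_map_closed
      simp flip: map_Comp map_loop)

lemma lf_part_LF_map: "lf_part (dgob_map (LF_map T) x) a = ob_map T (lf_part x a)"
  by (simp add: lf_part_def LF_map_def)

lemma lf_delta_LF_map: "lf_delta (dgob_map (LF_map T) x) a = lin_map (arr_map T) (lf_delta x a)"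
  by (simp add: lf_delta_def LF_map_def)

lemma dghom_map_LF_map: "dghom_map (LF_map T) i x y h = (\<lambda>a. lin_map (arr_map T) (h a))"
  by (simp add: LF_map_def)

text \<open>A linear extension respects the composition of the linear envelopes, and it takes the odd
  endomorphism of a loop factorization to that of its image; hence it commutes with the
  differential, which is built from these two alone.\<close>

lemma (in zfunctor) dg_functor_LF_map:
  "dg_functor (ring_of_type_algebra :: 'k::field ring) (LF C) (LF D) (LF_map F)"
proof (intro dg_functor.intro dg_functor_axioms.intro source.dg_category_LF target.dg_category_LF,
    unfold LF_simps, goal_cases)
  case (1 x)
  then show ?case by (rule dgob_map_LF_map)
next
  case (2 x y f i)
  then show ?case
    by (auto simp: lf_Hom_simps lf_part_LF_map dghom_map_LF_map intro: lin_map_closed)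
next
  case (5 x)
  then show ?case
    by (auto simp: dghom_map_LF_map lf_Id_def lf_part_LF_map map_Id lf_part_closed)
next
  case (6 x y z f i g j)
  show ?case
  proof
    fix a
    have "f (a + j) \<in> lin_Hom C (lf_part x (a + j + i)) (lf_part y (a + j))"
      "g a \<in> lin_Hom C (lf_part y (a + j)) (lf_part z a)"
      using 6 by (auto simp: lf_Hom_simps)
    from lin_map_Comp[OF this]
    show "dghom_map (LF_map F) (j + i) x z (lf_Comp C j g f) a =
      lf_Comp D j (dghom_map (LF_map F) j y z g) (dghom_map (LF_map F) i x y f) a"
      by (simp add: dghom_map_LF_map lf_Comp_def)
  qed
next
  case (7 x y f i)
  show ?case
  proof
    fix a
    have f0: "f a \<in> lin_Hom C (lf_part x (a + i)) (lf_part y a)"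
      and f1: "f (a + 1) \<in> lin_Hom C (lf_part x (a + 1 + i)) (lf_part y (a + 1))"
      using 7 by (auto simp: lf_Hom_simps)
    show "dghom_map (LF_map F) (i + 1) x y (lf_Diff C i x y f) a =
      lf_Diff D i (dgob_map (LF_map F) x) (dgob_map (LF_map F) y) (dghom_map (LF_map F) i x y f) a"
      using lin_map_Comp[OF f1 lf_delta_closed[OF 7(2), of a]]
        lin_map_Comp[OF lf_delta_closed[OF 7(1), of "a + i"] f0]
      by (simp add: dghom_map_LF_map lf_Diff_apply lf_delta_LF_map lin_map_diff lin_map_koszul)
  qed
qed (auto simp: dghom_map_LF_map lf_Hom_simps lin_map_add lin_map_scale)

section \<open>Connes' cyclic category\<close>

text \<open>Restriction picks one representative of each functor on its source, so the laws of the category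
  follow from those of plain composition once restrictions inside a composite can be dropped.\<close>

lemma functor_restrict_eq_iff:
  "functor_restrict C F = functor_restrict C G \<longleftrightarrow>
    (\<forall>x\<in>Ob C. ob_map F x = ob_map G x) \<and> (\<forall>f\<in>Arr C. arr_map F f = arr_map G f)"
  by (auto simp: functor_restrict_def fun_eq_iff restrict_def)

lemma functor_restrict_simps:
  "x \<in> Ob C \<Longrightarrow> ob_map (functor_restrict C F) x = ob_map F x"
  "f \<in> Arr C \<Longrightarrow> arr_map (functor_restrict C F) f = arr_map F f"
  "f \<in> Hom C x y \<Longrightarrow> arr_map (functor_restrict C F) f = arr_map F f"
  by (simp_all add: functor_restrict_def Hom_def)

lemma functor_restrict_idem [simp]:
  "functor_restrict C (functor_restrict C F) = functor_restrict C F"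
  by (simp add: functor_restrict_eq_iff functor_restrict_simps)

lemma functor_comp_simps:
  "ob_map (functor_comp G F) x = ob_map G (ob_map F x)"
  "arr_map (functor_comp G F) f = arr_map G (arr_map F f)"
  by (simp_all add: functor_comp_def)

lemma functor_id_simps: "ob_map functor_id x = x" "arr_map functor_id f = f"
  by (simp_all add: functor_id_def)

lemma (in category) Hom_Ob: "f \<in> Hom C x y \<Longrightarrow> x \<in> Ob C" "f \<in> Hom C x y \<Longrightarrow> y \<in> Ob C"
  using Dom_closed Cod_closed by (auto simp: Hom_def)

lemma (in cat_functor) arr_map_Arr: "f \<in> Arr C \<Longrightarrow> arr_map F f \<in> Arr D"
  using arr_map_closed by (auto simp: Hom_def)

lemma zfunctor_restrict:
  assumes "zfunctor C D F"
  shows "zfunctor C D (functor_restrict C F)"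
proof -
  interpret zfunctor C D F by fact
  show ?thesis
  proof unfold_locales
    show "arr_map (functor_restrict C F) (Comp C g f) =
        Comp D (arr_map (functor_restrict C F) g) (arr_map (functor_restrict C F) f)"
      if "f \<in> Hom C x y" "g \<in> Hom C y z" for f g x y z
      using source.Comp_closed[OF that] that by (simp add: functor_restrict_simps map_Comp)
  qed (auto simp: functor_restrict_simps functor_restrict_simps(3)[OF source.Id_closed]
      functor_restrict_simps(3)[OF source.loop_closed] source.Hom_Ob ob_map_closed
      arr_map_closed map_Id map_loop)
qed

lemma zfunctor_id: "zcategory C \<Longrightarrow> zfunctor C C functor_id"
  by (simp add: zfunctor_def cat_functor_def cat_functor_axioms_def zfunctor_axioms_def
      zcategory.axioms functor_id_simps)

lemma zfunctor_comp:
  assumes "zfunctor C D F" and "zfunctor D E G"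
  shows "zfunctor C E (functor_comp G F)"
proof -
  interpret F: zfunctor C D F by fact
  interpret G: zfunctor D E G by fact
  show ?thesis
    by unfold_locales
      (auto simp: functor_comp_simps F.ob_map_closed G.ob_map_closed F.map_Id G.map_Id
        F.map_loop G.map_loop F.map_Comp intro: F.arr_map_closed G.arr_map_closed G.map_Comp)
qed

lemma Lambda_simps:
  "Ob Lambda = UNIV"
  "Dom Lambda (m, n, F) = m"
  "Cod Lambda (m, n, F) = n"
  "Id Lambda n = (n, n, functor_restrict (QQ n) functor_id)"
  "Comp Lambda (n', r, G) (m, n, F) = (m, r, functor_restrict (QQ m) (functor_comp G F))"
  by (simp_all add: Lambda_def)

lemma Hom_Lambda:
  "Hom Lambda m n = {(m, n, F) |F. zfunctor (QQ m) (QQ n) F \<and> functor_restrict (QQ m) F = F}"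
  by (auto simp: Hom_def Lambda_def)

lemma functor_comp_restrict_right:
  "functor_restrict C (functor_comp G (functor_restrict C F)) = functor_restrict C (functor_comp G F)"
  by (simp add: functor_restrict_eq_iff functor_comp_simps functor_restrict_simps)

text \<open>A functor takes its source into the domain of definition of the next one, so cutting off the next
  one outside this domain has no effect.\<close>

lemma functor_comp_restrict_left:
  assumes "cat_functor C D F"
  shows "functor_restrict C (functor_comp (functor_restrict D G) F) =
    functor_restrict C (functor_comp G F)"
  using cat_functor.ob_map_closed[OF assms] cat_functor.arr_map_Arr[OF assms]
  by (simp add: functor_restrict_eq_iff functor_comp_simps functor_restrict_simps)

lemma functor_comp_id: "functor_comp F functor_id = F" "functor_comp functor_id F = F"
  by (simp_all add: functor_comp_def functor_id_def comp_def)

lemma functor_comp_assoc: "functor_comp (functor_comp H G) F = functor_comp H (functor_comp G F)"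
  by (simp add: functor_comp_def comp_assoc)

lemma category_Lambda: "category Lambda"
proof
  show "Id Lambda n \<in> Hom Lambda n n" for n
    by (simp add: Hom_Lambda Lambda_simps zfunctor_restrict zfunctor_id zcategory_QQ)
  show "Comp Lambda g f \<in> Hom Lambda x z"
    if "f \<in> Hom Lambda x y" "g \<in> Hom Lambda y z" for f g x y z
    using that
    by (auto simp: Hom_Lambda Lambda_simps) (erule (1) zfunctor_restrict[OF zfunctor_comp])
  show "Comp Lambda f (Id Lambda x) = f" if "f \<in> Hom Lambda x y" for f x y
    using that by (auto simp: Hom_Lambda Lambda_simps functor_comp_restrict_right functor_comp_id)
  show "Comp Lambda (Id Lambda y) f = f" if "f \<in> Hom Lambda x y" for f x y
    using that
    by (auto simp: Hom_Lambda Lambda_simps functor_comp_restrict_left zfunctor.axioms functor_comp_id)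
  show "Comp Lambda (Comp Lambda h g) f = Comp Lambda h (Comp Lambda g f)"
    if "f \<in> Hom Lambda w x" "g \<in> Hom Lambda x y" "h \<in> Hom Lambda y z" for f g h w x y z
    using that
    by (auto simp: Hom_Lambda Lambda_simps functor_comp_restrict_left functor_comp_restrict_right
        zfunctor.axioms functor_comp_assoc)
qed (auto simp: Lambda_simps)

section \<open>The category of dg-categories\<close>

text \<open>A restricted functor keeps its values only on morphisms of its source. That it is still linear
  thus rests on the next two closure properties.\<close>

lemma (in dg_category) Hom_add_closed:
  assumes "x \<in> dgOb A" "y \<in> dgOb A" "f \<in> carrier (dgHom A i x y)" "g \<in> carrier (dgHom A i x y)"
  shows "f \<oplus>\<^bsub>dgHom A i x y\<^esub> g \<in> carrier (dgHom A i x y)"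
proof -
  interpret Module.module K "dgHom A i x y" by (rule Hom_module) fact+
  show ?thesis using assms by simp
qed

lemma (in dg_category) Hom_smult_closed:
  assumes "x \<in> dgOb A" "y \<in> dgOb A" "c \<in> carrier K" "f \<in> carrier (dgHom A i x y)"
  shows "c \<odot>\<^bsub>dgHom A i x y\<^esub> f \<in> carrier (dgHom A i x y)"
proof -
  interpret Module.module K "dgHom A i x y" by (rule Hom_module) fact+
  show ?thesis using assms by simp
qed

lemma dgfunctor_restrict_eq_iff:
  "dgfunctor_restrict A F = dgfunctor_restrict A G \<longleftrightarrow>
    (\<forall>x\<in>dgOb A. dgob_map F x = dgob_map G x) \<and>
    (\<forall>x\<in>dgOb A. \<forall>y\<in>dgOb A. \<forall>i. \<forall>f\<in>carrier (dgHom A i x y).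
      dghom_map F i x y f = dghom_map G i x y f)"
  by (auto simp: dgfunctor_restrict_def fun_eq_iff restrict_def)

lemma dgfunctor_restrict_simps:
  "x \<in> dgOb A \<Longrightarrow> dgob_map (dgfunctor_restrict A F) x = dgob_map F x"
  "\<lbrakk>x \<in> dgOb A; y \<in> dgOb A; f \<in> carrier (dgHom A i x y)\<rbrakk> \<Longrightarrow>
    dghom_map (dgfunctor_restrict A F) i x y f = dghom_map F i x y f"
  by (simp_all add: dgfunctor_restrict_def)

lemma dgfunctor_restrict_idem [simp]:
  "dgfunctor_restrict A (dgfunctor_restrict A F) = dgfunctor_restrict A F"
  by (simp add: dgfunctor_restrict_eq_iff dgfunctor_restrict_simps)

lemma dgfunctor_comp_simps:
  "dgob_map (dgfunctor_comp G F) x = dgob_map G (dgob_map F x)"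
  "dghom_map (dgfunctor_comp G F) i x y f =
    dghom_map G i (dgob_map F x) (dgob_map F y) (dghom_map F i x y f)"
  by (simp_all add: dgfunctor_comp_def)

lemma dgfunctor_id_simps: "dgob_map dgfunctor_id x = x" "dghom_map dgfunctor_id i x y f = f"
  by (simp_all add: dgfunctor_id_def)

lemma dg_functor_restrict:
  assumes "dg_functor K A B F"
  shows "dg_functor K A B (dgfunctor_restrict A F)"
proof -
  interpret dg_functor K A B F by fact
  show ?thesis
    by unfold_locales
      (simp_all add: dgfunctor_restrict_simps ob_map_closed hom_map_closed map_add map_smult
        map_Id map_Comp map_Diff source.Hom_add_closed source.Hom_smult_closed source.Id_closed
        source.Comp_closed source.Diff_closed)
qed

lemma dg_functor_id: "dg_category K A \<Longrightarrow> dg_functor K A A dgfunctor_id"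
  by (simp add: dg_functor_def dg_functor_axioms_def dgfunctor_id_simps)

lemma dg_functor_comp:
  assumes "dg_functor K A B F" and "dg_functor K B C G"
  shows "dg_functor K A C (dgfunctor_comp G F)"
proof -
  interpret F: dg_functor K A B F by fact
  interpret G: dg_functor K B C G by fact
  show ?thesis
    by unfold_locales
      (simp_all add: dgfunctor_comp_simps F.ob_map_closed F.hom_map_closed F.map_add F.map_smult
        F.map_Id F.map_Comp F.map_Diff G.ob_map_closed G.hom_map_closed G.map_add G.map_smult
        G.map_Id G.map_Comp G.map_Diff)
qed

lemma dgfunctor_comp_restrict_right:
  "dgfunctor_restrict A (dgfunctor_comp G (dgfunctor_restrict A F)) =
    dgfunctor_restrict A (dgfunctor_comp G F)"
  by (simp add: dgfunctor_restrict_eq_iff dgfunctor_comp_simps dgfunctor_restrict_simps)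

lemma dgfunctor_comp_restrict_left:
  assumes "dg_functor K A B F"
  shows "dgfunctor_restrict A (dgfunctor_comp (dgfunctor_restrict B G) F) =
    dgfunctor_restrict A (dgfunctor_comp G F)"
  using dg_functor.ob_map_closed[OF assms] dg_functor.hom_map_closed[OF assms]
  by (simp add: dgfunctor_restrict_eq_iff dgfunctor_comp_simps dgfunctor_restrict_simps)

lemma dgfunctor_comp_id: "dgfunctor_comp F dgfunctor_id = F" "dgfunctor_comp dgfunctor_id F = F"
  by (simp_all add: dgfunctor_comp_def dgfunctor_id_def comp_def)

lemma dgfunctor_comp_assoc:
  "dgfunctor_comp (dgfunctor_comp H G) F = dgfunctor_comp H (dgfunctor_comp G F)"
  by (simp add: dgfunctor_comp_def comp_def)

lemma dgcat_simps:
  "Ob (dgcat K) = {A. dg_category K A}"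
  "Dom (dgcat K) (A, B, F) = A"
  "Cod (dgcat K) (A, B, F) = B"
  "Id (dgcat K) A = (A, A, dgfunctor_restrict A dgfunctor_id)"
  "Comp (dgcat K) (B', C, G) (A, B, F) = (A, C, dgfunctor_restrict A (dgfunctor_comp G F))"
  by (simp_all add: dgcat_def)

lemma Hom_dgcat:
  "Hom (dgcat K) A B = {(A, B, F) |F. dg_functor K A B F \<and> dgfunctor_restrict A F = F}"
  by (auto simp: Hom_def dgcat_def)

lemma category_dgcat: "category (dgcat K)"
proof
  fix f
  assume "f \<in> Arr (dgcat K)"
  then show "Dom (dgcat K) f \<in> Ob (dgcat K)" and "Cod (dgcat K) f \<in> Ob (dgcat K)"
    by (auto simp: dgcat_def dest: dg_functor.axioms)
next
  show "Id (dgcat K) A \<in> Hom (dgcat K) A A" if "A \<in> Ob (dgcat K)" for A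
    using that by (simp add: Hom_dgcat dgcat_simps dg_functor_restrict dg_functor_id)
  show "Comp (dgcat K) g f \<in> Hom (dgcat K) x z"
    if "f \<in> Hom (dgcat K) x y" "g \<in> Hom (dgcat K) y z" for f g x y z
    using that
    by (auto simp: Hom_dgcat dgcat_simps) (erule (1) dg_functor_restrict[OF dg_functor_comp])
  show "Comp (dgcat K) f (Id (dgcat K) x) = f" if "f \<in> Hom (dgcat K) x y" for f x y
    using that
    by (auto simp: Hom_dgcat dgcat_simps dgfunctor_comp_restrict_right dgfunctor_comp_id)
  show "Comp (dgcat K) (Id (dgcat K) y) f = f" if "f \<in> Hom (dgcat K) x y" for f x y
    using that
    by (auto simp: Hom_dgcat dgcat_simps dgfunctor_comp_restrict_left dgfunctor_comp_id)
  show "Comp (dgcat K) (Comp (dgcat K) h g) f = Comp (dgcat K) h (Comp (dgcat K) g f)"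
    if "f \<in> Hom (dgcat K) w x" "g \<in> Hom (dgcat K) x y" "h \<in> Hom (dgcat K) y z"
    for f g h w x y z
    using that
    by (auto simp: Hom_dgcat dgcat_simps dgfunctor_comp_restrict_left
        dgfunctor_comp_restrict_right dgfunctor_comp_assoc)
qed

section \<open>The cocyclic object\<close>

text \<open>The construction on \<open>LF C\<close> evaluates the functor only at objects and arrows of \<open>C\<close>, because the
  combinations in a block are supported on arrows of \<open>C\<close>.\<close>

lemma LF_map_restrict:
  fixes C :: "('o, 'a, 'z) pre_zcategory_scheme"
  shows "dgfunctor_restrict (LF C :: ('k::field, _, _) pre_dgcategory)
      (LF_map (functor_restrict C T)) = dgfunctor_restrict (LF C) (LF_map T)"
  unfolding dgfunctor_restrict_eq_iff LF_simps
proof safe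
  fix F
  assume "F \<in> loop_factorizations C"
  then show "dgob_map (LF_map (functor_restrict C T)) F = dgob_map (LF_map T) F"
    by (simp add: LF_map_def loop_factorizations_def Hom_def functor_restrict_simps)
next
  fix F F' i and h :: "bit \<Rightarrow> 'a \<Rightarrow>\<^sub>0 'k"
  assume "h \<in> carrier (lf_Hom C i F F')"
  then have "Poly_Mapping.keys (h a) \<subseteq> Arr C" for a
    by (auto simp: lf_Hom_simps lin_Hom_def Hom_def subset_iff)
  then show "dghom_map (LF_map (functor_restrict C T)) i F F' h = dghom_map (LF_map T) i F F' h"
    by (auto simp: dghom_map_LF_map functor_restrict_simps subset_iff intro!: lin_map_cong)
qed

lemma LF_map_id: "LF_map functor_id = dgfunctor_id"
  by (auto simp: LF_map_def dgfunctor_id_def functor_id_def lin_map_ident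
      intro!: ext loop_factorization.equality)

text \<open>Equality on the nose, which is what a strict functor from the cyclic category requires.\<close>

lemma LF_map_comp: "LF_map (functor_comp S T) = dgfunctor_comp (LF_map S) (LF_map T)"
  by (simp add: LF_map_def dgfunctor_comp_def functor_comp_def comp_def lin_map_lin_map)

lemma EE_simps:
  "ob_map EE n = LF (QQ n)"
  "arr_map EE (m, n, T) =
    (LF (QQ m), LF (QQ n), dgfunctor_restrict (LF (QQ m)) (LF_map T))"
  by (simp_all add: EE_def)

theorem proposition2p4p1:
  shows "cocyclic_object (dgcat (ring_of_type_algebra :: 'k::field ring)) EE"
  unfolding cocyclic_object_def
proof (intro cat_functor.intro cat_functor_axioms.intro category_Lambda category_dgcat)
  let ?D = "dgcat (ring_of_type_algebra :: 'k ring)"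
  show "ob_map EE n \<in> Ob ?D" for n
    by (simp add: EE_simps dgcat_simps zcategory.dg_category_LF zcategory_QQ)
  show "arr_map EE f \<in> Hom ?D (ob_map EE m) (ob_map EE n)" if "f \<in> Hom Lambda m n" for f m n
    using that
    by (auto simp: Hom_Lambda Hom_dgcat EE_simps dg_functor_restrict zfunctor.dg_functor_LF_map)
  show "arr_map EE (Id Lambda n) = Id ?D (ob_map EE n)" for n
    by (simp add: Lambda_simps dgcat_simps EE_simps LF_map_restrict LF_map_id)
  show "arr_map EE (Comp Lambda g f) = Comp ?D (arr_map EE g) (arr_map EE f)"
    if "f \<in> Hom Lambda m n" and "g \<in> Hom Lambda n r" for f g m n r
    using that
    by (auto simp: Hom_Lambda Lambda_simps dgcat_simps EE_simps LF_map_restrict LF_map_comp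
        dgfunctor_comp_restrict_left[OF zfunctor.dg_functor_LF_map]
        dgfunctor_comp_restrict_right dgfunctor_comp_restrict_left[OF dg_functor_restrict]
        zfunctor.dg_functor_LF_map)
qed

end
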